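(* Fix a positive integer $n$. As $q\to\infty$ over prime powers, the number of pairs $(F,G)$ of polynomials in $\mathbb{F}_q[T]$ with $\deg(F)=\deg(G)=n$ and $\widetilde{\varphi}(F)=\widetilde{\sigma}(G)$ is $\gg q^n/n^2$.
   Context: For nonzero $F\in\mathbb{F}_q[T]$, $\widetilde{\sigma}(F)=\sum_{D\mid F}D\in\mathbb{F}_q[T]$, the sum over monic divisors $D$ of $F$, and $\widetilde{\varphi}(F)=\prod_{P\mid F}P^{v_P(F)-1}(P-1)\in\mathbb{F}_q[T]$, the product over monic irreducible polynomials $P$ dividing $F$, with $v_P(F)$ the exponent of $P$ in $F$. *)

theory Defs
  imports Complex_Main "HOL-Algebra.Polynomial_Divisibility" "HOL-Number_Theory.Prime_Powers"
begin

text \<open>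
  The ring of polynomials over a field \<open>R\<close> is \<^term>\<open>poly_ring R\<close>; its elements are coefficient
  lists with the (nonzero) leading coefficient first, and the zero polynomial is \<open>[]\<close>.
\<close>

definition monic_polys :: "('a, 'b) ring_scheme \<Rightarrow> 'a list set" where
  "monic_polys R = {P \<in> carrier (poly_ring R). P \<noteq> [] \<and> lead_coeff P = \<one>\<^bsub>R\<^esub>}"

definition poly_val :: "('a, 'b) ring_scheme \<Rightarrow> 'a list \<Rightarrow> 'a list \<Rightarrow> nat" where
  "poly_val R P F = (GREATEST k::nat. (P [^]\<^bsub>poly_ring R\<^esub> k) pdivides\<^bsub>R\<^esub> F)"

definition sigma_poly :: "('a, 'b) ring_scheme \<Rightarrow> 'a list \<Rightarrow> 'a list" where
  "sigma_poly R F = (\<Oplus>\<^bsub>poly_ring R\<^esub> D \<in> {D \<in> monic_polys R. D pdivides\<^bsub>R\<^esub> F}. D)"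

definition phi_poly :: "('a, 'b) ring_scheme \<Rightarrow> 'a list \<Rightarrow> 'a list" where
  "phi_poly R F =
     (\<Otimes>\<^bsub>poly_ring R\<^esub> P \<in> {P \<in> monic_polys R. pirreducible\<^bsub>R\<^esub> (carrier R) P \<and> P pdivides\<^bsub>R\<^esub> F}.
        (P [^]\<^bsub>poly_ring R\<^esub> (poly_val R P F - 1))
          \<otimes>\<^bsub>poly_ring R\<^esub> (P \<ominus>\<^bsub>poly_ring R\<^esub> \<one>\<^bsub>poly_ring R\<^esub>))"

definition phi_sigma_pairs :: "('a, 'b) ring_scheme \<Rightarrow> nat \<Rightarrow> ('a list \<times> 'a list) set" where
  "phi_sigma_pairs R n =
     {(F, G). F \<in> carrier (poly_ring R) \<and> G \<in> carrier (poly_ring R) \<and>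
              degree F = n \<and> degree G = n \<and> phi_poly R F = sigma_poly R G}"

end

theory Submission
  imports Defs
begin

text \<open>
  Leading coefficients are free in the count, and \<open>phi_poly\<close> and \<open>sigma_poly\<close> do not see them.
  For a set \<open>U\<close> of \<open>n\<close> field elements, the product of the \<open>T - (u - 1)\<close> has
  totient \<open>\<Prod> (T - u)\<close>, and the product of the \<open>T - (u + 1)\<close> has divisor sum
  \<open>\<Prod> (T - u)\<close>. Multiplying the first polynomial by an arbitrary nonzero constant yields
  \<open>(q - 1) * (q choose n) \<ge> (q - 1) * (q / n) ^ n\<close> pairs, which exceeds \<open>q ^ n\<close> as soon
  as \<open>q > n ^ n\<close>.
\<close>

section \<open>Expansion of a product of binomials over subsets\<close>

text \<open>By induction: the subsets of \<open>insert x S\<close> are those of \<open>S\<close>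
  together with the same sets enlarged by \<open>x\<close>, and the second family contributes
  \<open>f x\<close> times the first. With linear polynomials for \<open>f\<close>, the right side
  becomes a sum over the monic divisors of a squarefree split polynomial.\<close>

lemma (in cring) finprod_one_add_eq_finsum_Pow:
  assumes "finite S" "f \<in> S \<rightarrow> carrier R"
  shows "(\<Otimes>a\<in>S. \<one> \<oplus> f a) = (\<Oplus>A\<in>Pow S. \<Otimes>a\<in>A. f a)"
  using assms
proof (induction S rule: finite_induct)
  case empty
  then show ?case by simp
next
  case (insert x S)
  have fx: "f x \<in> carrier R" and fS: "f \<in> S \<rightarrow> carrier R"
    using insert.prems by auto
  have fA: "(\<Otimes>a\<in>A. f a) \<in> carrier R" if "A \<subseteq> insert x S" for A
    using that insert.prems by (intro finprod_closed) auto
  have inj: "inj_on (insert x) (Pow S)"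
    using insert.hyps by (auto simp: inj_on_def)
  have "(\<Oplus>A\<in>Pow (insert x S). \<Otimes>a\<in>A. f a)
      = (\<Oplus>A\<in>Pow S. \<Otimes>a\<in>A. f a) \<oplus> (\<Oplus>A\<in>insert x ` Pow S. \<Otimes>a\<in>A. f a)"
    unfolding Pow_insert using insert.hyps fA
    by (intro add.finprod_Un_disjoint) (auto, blast+)
  also have "(\<Oplus>A\<in>insert x ` Pow S. \<Otimes>a\<in>A. f a) = (\<Oplus>A\<in>Pow S. \<Otimes>a\<in>insert x A. f a)"
    using inj by (intro add.finprod_reindex) (auto intro!: fA)
  also have "\<dots> = (\<Oplus>A\<in>Pow S. f x \<otimes> (\<Otimes>a\<in>A. f a))"
  proof (rule add.finprod_cong')
    fix A assume "A \<in> Pow S"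
    then have "x \<notin> A" "finite A" "f \<in> A \<rightarrow> carrier R"
      using insert.hyps fS finite_subset by auto
    then show "(\<Otimes>a\<in>insert x A. f a) = f x \<otimes> (\<Otimes>a\<in>A. f a)"
      using fx by simp
  qed (use fA fx in auto)
  also have "\<dots> = f x \<otimes> (\<Oplus>A\<in>Pow S. \<Otimes>a\<in>A. f a)"
    using fx fA insert.hyps by (intro finsum_rdistr[symmetric]) auto
  finally have *: "(\<Oplus>A\<in>Pow (insert x S). \<Otimes>a\<in>A. f a)
      = (\<Oplus>A\<in>Pow S. \<Otimes>a\<in>A. f a) \<oplus> f x \<otimes> (\<Oplus>A\<in>Pow S. \<Otimes>a\<in>A. f a)" .
  have sum: "(\<Oplus>A\<in>Pow S. \<Otimes>a\<in>A. f a) \<in> carrier R"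
    using fA by (intro finsum_closed) auto
  have "(\<Otimes>a\<in>insert x S. \<one> \<oplus> f a) = (\<one> \<oplus> f x) \<otimes> (\<Otimes>a\<in>S. \<one> \<oplus> f a)"
    using insert.hyps fx fS by (intro finprod_insert) auto
  also have "\<dots> = (\<one> \<oplus> f x) \<otimes> (\<Oplus>A\<in>Pow S. \<Otimes>a\<in>A. f a)"
    using insert.IH[OF fS] by simp
  also have "\<dots> = (\<Oplus>A\<in>Pow (insert x S). \<Otimes>a\<in>A. f a)"
    unfolding * using fx sum by (simp add: l_distr)
  finally show ?case .
qed

section \<open>Monic linear polynomials and their products over sets of roots\<close>

definition lin_poly :: "('a, 'b) ring_scheme \<Rightarrow> 'a \<Rightarrow> 'a list" where
  "lin_poly R a = [\<one>\<^bsub>R\<^esub>, \<ominus>\<^bsub>R\<^esub> a]"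

text \<open>Indexing by a set makes each factor occur once. For finite \<open>S\<close> inside a
  field the polynomial is therefore squarefree, so that its monic divisors correspond to the subsets
  of \<open>S\<close>.\<close>

definition split_poly :: "('a, 'b) ring_scheme \<Rightarrow> 'a set \<Rightarrow> 'a list" where
  "split_poly R S = (\<Otimes>\<^bsub>poly_ring R\<^esub> a\<in>S. lin_poly R a)"

context field
begin

interpretation UP: domain "poly_ring R"
  by (rule univ_poly_is_domain[OF carrier_is_subring])

lemma lin_poly_carrier [simp]:
  "a \<in> carrier R \<Longrightarrow> lin_poly R a \<in> carrier (poly_ring R)"
  by (auto simp: lin_poly_def univ_poly_carrier[symmetric] polynomial_def)

lemma lin_poly_monic [simp]: "a \<in> carrier R \<Longrightarrow> lin_poly R a \<in> monic_polys R"
  using lin_poly_carrier by (simp add: monic_polys_def lin_poly_def)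

lemma inj_on_lin_poly: "inj_on (lin_poly R) (carrier R)"
  by (rule inj_onI) (metis lin_poly_def list.inject minus_minus)

text \<open>The monic divisors of a monic linear polynomial are 1 and itself, so this is its divisor
  sum: sigma lowers the root by one. The counterpart \<open>lin_poly_minus_one\<close> shows the
  totient raising the root by one.\<close>

lemma one_add_lin_poly:
  assumes "a \<in> carrier R"
  shows "\<one>\<^bsub>poly_ring R\<^esub> \<oplus>\<^bsub>poly_ring R\<^esub> lin_poly R a = lin_poly R (a \<ominus> \<one>)"
  using assms by (simp add: lin_poly_def univ_poly_one univ_poly_add a_minus_def minus_add a_comm)

lemma lin_poly_minus_one:
  assumes "a \<in> carrier R"
  shows "lin_poly R a \<ominus>\<^bsub>poly_ring R\<^esub> \<one>\<^bsub>poly_ring R\<^esub> = lin_poly R (a \<oplus> \<one>)"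
proof -
  have "lin_poly R a = \<one>\<^bsub>poly_ring R\<^esub> \<oplus>\<^bsub>poly_ring R\<^esub> lin_poly R (a \<oplus> \<one>)"
    using one_add_lin_poly[of "a \<oplus> \<one>"] assms by (simp add: a_minus_def a_assoc r_neg)
  then show ?thesis
    using assms UP.a_comm[of "\<one>\<^bsub>poly_ring R\<^esub>" "lin_poly R (a \<oplus> \<one>)"]
    by (simp add: a_minus_def UP.a_assoc UP.r_neg)
qed

section \<open>Monic polynomials: cofactors, degrees and primes\<close>

text \<open>Leading coefficients multiply, and that of \<open>P\<close> is one. Cofactors thus stay
  monic, which lets later divisibility arguments end in equalities and not only in
  associates.\<close>

lemma monic_polys_cancel:
  assumes "P \<in> monic_polys R" "E \<in> carrier (poly_ring R)"
    "P \<otimes>\<^bsub>poly_ring R\<^esub> E \<in> monic_polys R"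
  shows "E \<in> monic_polys R"
proof -
  have ne: "E \<noteq> []"
    using assms UP.r_null[of P] by (auto simp: monic_polys_def univ_poly_zero)
  have "lead_coeff (P \<otimes>\<^bsub>poly_ring R\<^esub> E) = lead_coeff P \<otimes> lead_coeff E"
    using assms ne unfolding univ_poly_mult
    by (intro poly_mult_lead_coeff[OF carrier_is_subring])
      (auto simp: monic_polys_def univ_poly_carrier)
  moreover have "lead_coeff E \<in> carrier R"
    using assms(2) ne by (auto simp: univ_poly_carrier[symmetric] polynomial_def)
  ultimately show ?thesis
    using assms ne by (simp add: monic_polys_def)
qed

lemma monic_polys_mult:
  assumes "P \<in> monic_polys R" "Q \<in> monic_polys R"
  shows "P \<otimes>\<^bsub>poly_ring R\<^esub> Q \<in> monic_polys R"
proof -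
  have "lead_coeff (P \<otimes>\<^bsub>poly_ring R\<^esub> Q) = lead_coeff P \<otimes> lead_coeff Q"
    using assms unfolding univ_poly_mult
    by (intro poly_mult_lead_coeff[OF carrier_is_subring])
      (auto simp: monic_polys_def univ_poly_carrier)
  moreover have "P \<otimes>\<^bsub>poly_ring R\<^esub> Q \<noteq> []"
    using assms UP.integral[of P Q] by (auto simp: monic_polys_def univ_poly_zero)
  ultimately show ?thesis
    using assms by (auto simp: monic_polys_def)
qed

lemma degree_poly_ring_mult:
  assumes "P \<in> carrier (poly_ring R)" "Q \<in> carrier (poly_ring R)" "P \<noteq> []" "Q \<noteq> []"
  shows "degree (P \<otimes>\<^bsub>poly_ring R\<^esub> Q) = degree P + degree Q"
  using assms poly_mult_degree_eq[OF carrier_is_subring, of P Q]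
  by (simp add: univ_poly_mult univ_poly_carrier)

lemma monic_degree_0:
  assumes "P \<in> monic_polys R" "degree P = 0"
  shows "P = \<one>\<^bsub>poly_ring R\<^esub>"
  using assms by (cases P) (auto simp: monic_polys_def univ_poly_one)

lemma monic_pdivides_one:
  assumes "P \<in> monic_polys R" "P pdivides \<one>\<^bsub>poly_ring R\<^esub>"
  shows "P = \<one>\<^bsub>poly_ring R\<^esub>"
proof -
  obtain E where E: "E \<in> carrier (poly_ring R)" "\<one>\<^bsub>poly_ring R\<^esub> = P \<otimes>\<^bsub>poly_ring R\<^esub> E"
    using assms(2) by (auto simp: pdivides_def elim: dividesE)
  have "E \<noteq> []"
    using E assms UP.r_null[of P] UP.one_not_zero by (auto simp: monic_polys_def univ_poly_zero)
  then have "degree \<one>\<^bsub>poly_ring R\<^esub> = degree P + degree E"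
    using assms E degree_poly_ring_mult by (auto simp: monic_polys_def)
  then show ?thesis
    using assms monic_degree_0 by (simp add: univ_poly_one)
qed

text \<open>Degrees add up to 1 and only the unit has degree 0 among monic polynomials, so
  \<open>P\<close> takes the whole degree and the monic cofactor is the unit.\<close>

lemma monic_pdivides_lin_poly:
  assumes "P \<in> monic_polys R" "P \<noteq> \<one>\<^bsub>poly_ring R\<^esub>" "a \<in> carrier R" "P pdivides lin_poly R a"
  shows "P = lin_poly R a"
proof -
  obtain E where E: "E \<in> carrier (poly_ring R)" "lin_poly R a = P \<otimes>\<^bsub>poly_ring R\<^esub> E"
    using assms(4) by (auto simp: pdivides_def elim: dividesE)
  have monic: "E \<in> monic_polys R"
    using E assms monic_polys_cancel[of P E] lin_poly_monic[of a] by simp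
  have "degree (lin_poly R a) = degree P + degree E"
    using monic E assms degree_poly_ring_mult by (auto simp: monic_polys_def)
  moreover have "degree P \<noteq> 0"
    using assms monic_degree_0 by blast
  ultimately have "degree E = 0"
    by (simp add: lin_poly_def)
  then show ?thesis
    using monic_degree_0[OF monic] E assms by (simp add: monic_polys_def)
qed

lemma monic_pirreducible_prime:
  assumes "P \<in> monic_polys R" "pirreducible (carrier R) P"
  shows "Divisibility.prime (poly_ring R) P" "P \<noteq> \<one>\<^bsub>poly_ring R\<^esub>"
proof -
  have carr: "P \<in> carrier (poly_ring R)"
    using assms by (simp add: monic_polys_def)
  show "Divisibility.prime (poly_ring R) P"
    using pprime_iff_pirreducible[OF carrier_is_subfield carr] assms
    by (simp add: ring_prime_def)
  show "P \<noteq> \<one>\<^bsub>poly_ring R\<^esub>"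
    using pirreducibleE(2)[OF carrier_is_subring carr assms(2)] UP.Units_one_closed by auto
qed

lemma lin_poly_pirreducible:
  "a \<in> carrier R \<Longrightarrow> pirreducible (carrier R) (lin_poly R a)"
  by (rule degree_one_imp_pirreducible[OF carrier_is_subfield]) (simp_all, simp add: lin_poly_def)

section \<open>Split polynomials: degree, divisors and recovery of the root set\<close>

lemma split_poly_carrier [simp]:
  "S \<subseteq> carrier R \<Longrightarrow> split_poly R S \<in> carrier (poly_ring R)"
  unfolding split_poly_def by (intro UP.finprod_closed) auto

lemma split_poly_empty [simp]: "split_poly R {} = \<one>\<^bsub>poly_ring R\<^esub>"
  by (simp add: split_poly_def)

lemma split_poly_insert:
  assumes "finite S" "insert a S \<subseteq> carrier R" "a \<notin> S"
  shows "split_poly R (insert a S) = lin_poly R a \<otimes>\<^bsub>poly_ring R\<^esub> split_poly R S"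
  unfolding split_poly_def using assms by (intro UP.finprod_insert) auto

lemma one_monic: "\<one>\<^bsub>poly_ring R\<^esub> \<in> monic_polys R"
  using UP.one_closed by (simp add: monic_polys_def univ_poly_one)

lemma split_poly_monic_degree:
  assumes "finite S" "S \<subseteq> carrier R"
  shows "split_poly R S \<in> monic_polys R \<and> degree (split_poly R S) = card S"
  using assms
proof (induction S rule: finite_induct)
  case empty
  then show ?case using one_monic by (simp add: univ_poly_one)
next
  case (insert a S)
  then have "degree (split_poly R (insert a S)) = degree (lin_poly R a) + degree (split_poly R S)"
    using degree_poly_ring_mult[of "lin_poly R a" "split_poly R S"] lin_poly_monic[of a]
    by (simp add: split_poly_insert monic_polys_def)
  moreover have "split_poly R (insert a S) \<in> monic_polys R"
    using insert by (simp add: split_poly_insert monic_polys_mult)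
  ultimately show ?case
    using insert by (simp add: lin_poly_def)
qed

text \<open>Irreducibles are prime here, so \<open>P\<close> divides one of the linear factors;
  being monic and different from the unit, it equals that factor.\<close>

lemma pirreducible_pdivides_split_poly:
  assumes "finite S" "S \<subseteq> carrier R" "P \<in> monic_polys R" "pirreducible (carrier R) P"
    "P pdivides split_poly R S"
  shows "P \<in> lin_poly R ` S"
  using assms(1,2,5)
proof (induction S rule: finite_induct)
  case empty
  then show ?case
    using monic_pdivides_one monic_pirreducible_prime(2) assms(3,4) by auto
next
  case (insert a S)
  have "lin_poly R a \<in> carrier (poly_ring R)" "split_poly R S \<in> carrier (poly_ring R)"
    using insert.prems by auto
  moreover have "P divides\<^bsub>poly_ring R\<^esub> lin_poly R a \<otimes>\<^bsub>poly_ring R\<^esub> split_poly R S"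
    using insert.prems insert.hyps by (simp add: split_poly_insert pdivides_def)
  ultimately have "P pdivides lin_poly R a \<or> P pdivides split_poly R S"
    using monic_pirreducible_prime(1)[OF assms(3,4)]
    unfolding pdivides_def by (blast elim: Divisibility.primeE)
  then show ?case
    using insert monic_pdivides_lin_poly[OF assms(3) monic_pirreducible_prime(2)[OF assms(3,4)]]
    by auto
qed

text \<open>Membership in the root set is read off from divisibility, without evaluating
  polynomials. This is what makes \<open>split_poly\<close> injective on finite sets.\<close>

lemma lin_poly_pdivides_split_poly_iff:
  assumes "finite S" "S \<subseteq> carrier R" "a \<in> carrier R"
  shows "lin_poly R a pdivides split_poly R S \<longleftrightarrow> a \<in> S"
proof
  assume "lin_poly R a pdivides split_poly R S"
  then have "lin_poly R a \<in> lin_poly R ` S"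
    using assms pirreducible_pdivides_split_poly lin_poly_pirreducible by simp
  then show "a \<in> S"
    using assms inj_on_lin_poly by (auto simp: inj_on_def subset_iff)
next
  assume "a \<in> S"
  then have "split_poly R S = lin_poly R a \<otimes>\<^bsub>poly_ring R\<^esub> split_poly R (S - {a})"
    using assms split_poly_insert[of "S - {a}" a] by (auto simp: insert_absorb)
  moreover have "split_poly R (S - {a}) \<in> carrier (poly_ring R)"
    using assms by (intro split_poly_carrier) auto
  ultimately show "lin_poly R a pdivides split_poly R S"
    unfolding pdivides_def by (intro dividesI)
qed

lemma inj_on_split_poly: "inj_on (split_poly R) {S. finite S \<and> S \<subseteq> carrier R}"
proof (rule inj_onI)
  fix S T
  assume S: "S \<in> {S. finite S \<and> S \<subseteq> carrier R}" and T: "T \<in> {S. finite S \<and> S \<subseteq> carrier R}"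
    and eq: "split_poly R S = split_poly R T"
  have "a \<in> S \<longleftrightarrow> a \<in> T" if "a \<in> carrier R" for a
    using lin_poly_pdivides_split_poly_iff[of S a] lin_poly_pdivides_split_poly_iff[of T a]
      S T eq that by simp
  then show "S = T"
    using S T by auto
qed

text \<open>Induction on \<open>S\<close>, with \<open>E\<close> the cofactor of \<open>D\<close>:
  the prime \<open>lin_poly R a\<close> divides the product of \<open>D\<close> and
  \<open>E\<close>. If it divides \<open>D\<close>, cancelling it leaves a monic divisor of the
  smaller product, and \<open>a\<close> joins the subset found for that divisor. If it divides
  \<open>E\<close>, cancelling it shows that \<open>D\<close> itself divides the smaller
  product.\<close>

lemma monic_pdivides_split_poly:
  assumes "finite S" "S \<subseteq> carrier R" "D \<in> monic_polys R" "D pdivides split_poly R S"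
  shows "\<exists>A\<subseteq>S. D = split_poly R A"
  using assms
proof (induction S arbitrary: D rule: finite_induct)
  case empty
  then show ?case using monic_pdivides_one by auto
next
  case (insert a S)
  have a: "a \<in> carrier R" and S: "S \<subseteq> carrier R" and D: "D \<in> carrier (poly_ring R)"
    using insert.prems by (auto simp: monic_polys_def)
  have l0: "lin_poly R a \<noteq> \<zero>\<^bsub>poly_ring R\<^esub>"
    by (simp add: lin_poly_def univ_poly_zero)
  obtain E where E: "E \<in> carrier (poly_ring R)"
    "lin_poly R a \<otimes>\<^bsub>poly_ring R\<^esub> split_poly R S = D \<otimes>\<^bsub>poly_ring R\<^esub> E"
    using insert.prems insert.hyps by (auto simp: pdivides_def split_poly_insert elim: dividesE)
  have "lin_poly R a divides\<^bsub>poly_ring R\<^esub> D \<otimes>\<^bsub>poly_ring R\<^esub> E"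
    using E(2) S by (intro dividesI[of "split_poly R S"]) auto
  then consider "lin_poly R a divides\<^bsub>poly_ring R\<^esub> D" | "lin_poly R a divides\<^bsub>poly_ring R\<^esub> E"
    using monic_pirreducible_prime(1)[OF lin_poly_monic lin_poly_pirreducible, OF a a] D E(1)
    by (auto elim!: Divisibility.primeE)
  then show ?case
  proof cases
    case 1
    then obtain D' where D': "D' \<in> carrier (poly_ring R)" "D = lin_poly R a \<otimes>\<^bsub>poly_ring R\<^esub> D'"
      by (auto elim: dividesE)
    have "split_poly R S = D' \<otimes>\<^bsub>poly_ring R\<^esub> E"
      using E D' a S l0 UP.m_lcancel[of "lin_poly R a" "split_poly R S" "D' \<otimes>\<^bsub>poly_ring R\<^esub> E"]
      by (simp add: UP.m_assoc)
    then have "D' pdivides split_poly R S"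
      using E by (auto simp: pdivides_def)
    moreover have "D' \<in> monic_polys R"
      using D' insert.prems(2) a monic_polys_cancel[of "lin_poly R a" D'] by simp
    ultimately obtain A where A: "A \<subseteq> S" "D' = split_poly R A"
      using insert.IH S by blast
    then have "D = split_poly R (insert a A)"
      using D' insert.hyps a S finite_subset by (subst split_poly_insert) auto
    then show ?thesis using A by blast
  next
    case 2
    then obtain E' where E': "E' \<in> carrier (poly_ring R)" "E = lin_poly R a \<otimes>\<^bsub>poly_ring R\<^esub> E'"
      by (auto elim: dividesE)
    have "split_poly R S = D \<otimes>\<^bsub>poly_ring R\<^esub> E'"
      using E E' D a S l0 UP.m_lcancel[of "lin_poly R a" "split_poly R S" "D \<otimes>\<^bsub>poly_ring R\<^esub> E'"]
      by (simp add: UP.m_lcomm)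
    then have "D pdivides split_poly R S"
      using E' by (auto simp: pdivides_def)
    then show ?thesis
      using insert.IH[OF S insert.prems(2)] by blast
  qed
qed

lemma split_poly_pdivides_split_poly:
  assumes "finite S" "S \<subseteq> carrier R" "A \<subseteq> S"
  shows "split_poly R A pdivides split_poly R S"
proof -
  have "split_poly R (A \<union> (S - A)) = split_poly R A \<otimes>\<^bsub>poly_ring R\<^esub> split_poly R (S - A)"
    unfolding split_poly_def using assms finite_subset
    by (intro UP.finprod_Un_disjoint) auto
  moreover have "split_poly R (S - A) \<in> carrier (poly_ring R)"
    using assms by (intro split_poly_carrier) auto
  ultimately show ?thesis
    using assms by (auto simp: pdivides_def Un_absorb1)
qed

section \<open>Sigma and phi of split polynomials\<close>

text \<open>The monic divisors are the products over subsets, distinct for distinct subsets, so the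
  divisor sum is the expansion of the product of the sums 1 + (T - a). Each such factor is linear
  with its root shifted down.\<close>

lemma sigma_poly_split_poly:
  assumes "finite S" "S \<subseteq> carrier R"
  shows "sigma_poly R (split_poly R S) = (\<Otimes>\<^bsub>poly_ring R\<^esub> a\<in>S. lin_poly R (a \<ominus> \<one>))"
proof -
  have sub: "finite A" "A \<subseteq> carrier R" if "A \<subseteq> S" for A
    using that assms finite_subset by auto
  have "{D \<in> monic_polys R. D pdivides split_poly R S} = split_poly R ` Pow S"
    using assms monic_pdivides_split_poly[OF assms] split_poly_pdivides_split_poly
      split_poly_monic_degree sub by (auto simp: image_iff)
  then have "sigma_poly R (split_poly R S) = (\<Oplus>\<^bsub>poly_ring R\<^esub> D\<in>split_poly R ` Pow S. D)"
    by (simp add: sigma_poly_def)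
  also have "\<dots> = (\<Oplus>\<^bsub>poly_ring R\<^esub> A\<in>Pow S. split_poly R A)"
    using sub by (intro UP.add.finprod_reindex inj_on_subset[OF inj_on_split_poly]) auto
  also have "\<dots> = (\<Otimes>\<^bsub>poly_ring R\<^esub> a\<in>S. \<one>\<^bsub>poly_ring R\<^esub> \<oplus>\<^bsub>poly_ring R\<^esub> lin_poly R a)"
    unfolding split_poly_def using assms
    by (intro UP.finprod_one_add_eq_finsum_Pow[symmetric]) auto
  also have "\<dots> = (\<Otimes>\<^bsub>poly_ring R\<^esub> a\<in>S. lin_poly R (a \<ominus> \<one>))"
    using assms by (intro UP.finprod_cong') (auto intro!: one_add_lin_poly)
  finally show ?thesis .
qed

text \<open>If the square of the factor divided the product, cancelling one copy would leave
  \<open>lin_poly R a\<close> dividing the product over \<open>S - {a}\<close>, which does not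
  contain the root \<open>a\<close>.\<close>

lemma poly_val_lin_poly_split_poly:
  assumes "finite S" "S \<subseteq> carrier R" "a \<in> S"
  shows "poly_val R (lin_poly R a) (split_poly R S) = 1"
  unfolding poly_val_def
proof (rule Greatest_equality)
  have a: "a \<in> carrier R" using assms by auto
  show "lin_poly R a [^]\<^bsub>poly_ring R\<^esub> (1::nat) pdivides split_poly R S"
    using assms a by (simp add: lin_poly_pdivides_split_poly_iff)
  fix k :: nat
  assume div: "lin_poly R a [^]\<^bsub>poly_ring R\<^esub> k pdivides split_poly R S"
  show "k \<le> 1"
  proof (rule ccontr)
    assume "\<not> k \<le> 1"
    \<comment> \<open>An exponent of at least 2 exposes two copies of the factor: one to cancel, one
      to contradict. The remaining power and the cofactor are collected in \<open>M\<close>.\<close>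
    then obtain j where k: "k = Suc (Suc j)"
      by (metis One_nat_def Suc_le_mono not0_implies_Suc zero_le)
    let ?l = "lin_poly R a"
    have l0: "?l \<noteq> \<zero>\<^bsub>poly_ring R\<^esub>"
      by (simp add: lin_poly_def univ_poly_zero)
    have S': "split_poly R (S - {a}) \<in> carrier (poly_ring R)"
      using assms by (intro split_poly_carrier) auto
    obtain E where E: "E \<in> carrier (poly_ring R)"
      "split_poly R S = ?l [^]\<^bsub>poly_ring R\<^esub> k \<otimes>\<^bsub>poly_ring R\<^esub> E"
      using div by (auto simp: pdivides_def elim: dividesE)
    define M where "M = ?l [^]\<^bsub>poly_ring R\<^esub> j \<otimes>\<^bsub>poly_ring R\<^esub> E"
    have M: "M \<in> carrier (poly_ring R)"
      using E a by (simp add: M_def)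
    have "?l \<otimes>\<^bsub>poly_ring R\<^esub> split_poly R (S - {a}) = split_poly R S"
      using assms split_poly_insert[of "S - {a}" a] by (auto simp: insert_absorb)
    also have "\<dots> = ?l \<otimes>\<^bsub>poly_ring R\<^esub> (?l \<otimes>\<^bsub>poly_ring R\<^esub> M)"
      using E a by (simp add: k M_def UP.m_ac)
    finally have "split_poly R (S - {a}) = ?l \<otimes>\<^bsub>poly_ring R\<^esub> M"
      using a M S' l0 UP.m_lcancel[of ?l] by simp
    then have "?l pdivides split_poly R (S - {a})"
      using M by (auto simp: pdivides_def)
    then show False
      using assms a lin_poly_pdivides_split_poly_iff[of "S - {a}" a] by auto
  qed
qed

text \<open>The monic irreducible divisors are exactly the linear factors, each with exponent 1. The
  power in the totient thus has exponent 0, and only the factors P - 1 remain, with roots shifted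
  up.\<close>

lemma phi_poly_split_poly:
  assumes "finite S" "S \<subseteq> carrier R"
  shows "phi_poly R (split_poly R S) = (\<Otimes>\<^bsub>poly_ring R\<^esub> a\<in>S. lin_poly R (a \<oplus> \<one>))"
proof -
  let ?f = "\<lambda>P. (P [^]\<^bsub>poly_ring R\<^esub> (poly_val R P (split_poly R S) - 1))
          \<otimes>\<^bsub>poly_ring R\<^esub> (P \<ominus>\<^bsub>poly_ring R\<^esub> \<one>\<^bsub>poly_ring R\<^esub>)"
  have f: "?f (lin_poly R a) = lin_poly R (a \<oplus> \<one>)" if "a \<in> S" for a
    using that assms poly_val_lin_poly_split_poly[OF assms that] lin_poly_minus_one[of a]
    by (auto simp: subset_iff)
  have "{P \<in> monic_polys R. pirreducible (carrier R) P \<and> P pdivides split_poly R S}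
      = lin_poly R ` S"
    using assms pirreducible_pdivides_split_poly[OF assms] lin_poly_pirreducible
      lin_poly_pdivides_split_poly_iff by (auto simp: subset_iff)
  then have "phi_poly R (split_poly R S) = (\<Otimes>\<^bsub>poly_ring R\<^esub> P\<in>lin_poly R ` S. ?f P)"
    by (simp add: phi_poly_def)
  also have "\<dots> = (\<Otimes>\<^bsub>poly_ring R\<^esub> a\<in>S. ?f (lin_poly R a))"
    using assms f by (intro UP.finprod_reindex inj_on_subset[OF inj_on_lin_poly]) auto
  also have "\<dots> = (\<Otimes>\<^bsub>poly_ring R\<^esub> a\<in>S. lin_poly R (a \<oplus> \<one>))"
    using assms f by (intro UP.finprod_cong') auto
  finally show ?thesis .
qed

section \<open>Invariance of phi under nonzero constant factors\<close>

text \<open>A nonzero constant is a unit of the polynomial ring, so multiplying by it gives an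
  associate, which has the same divisors.\<close>

lemma pdivides_const_mult_iff:
  assumes "c \<in> carrier R - {\<zero>}" "F \<in> carrier (poly_ring R)" "D \<in> carrier (poly_ring R)"
  shows "D pdivides ([c] \<otimes>\<^bsub>poly_ring R\<^esub> F) \<longleftrightarrow> D pdivides F"
proof -
  have "[c] \<in> Units (poly_ring R)"
    using univ_poly_units[OF carrier_is_subfield] assms by auto
  then have c: "[c] \<in> carrier (poly_ring R)" and "F \<sim>\<^bsub>poly_ring R\<^esub> [c] \<otimes>\<^bsub>poly_ring R\<^esub> F"
    using assms UP.m_comm[of "[c]" F] UP.associatedI2'[of "[c] \<otimes>\<^bsub>poly_ring R\<^esub> F" F "[c]"]
      UP.Units_closed UP.associated_sym by auto
  then have "F divides\<^bsub>poly_ring R\<^esub> [c] \<otimes>\<^bsub>poly_ring R\<^esub> F"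
    and "[c] \<otimes>\<^bsub>poly_ring R\<^esub> F divides\<^bsub>poly_ring R\<^esub> F"
    by (simp_all add: associated_def)
  then show ?thesis
    unfolding pdivides_def using UP.divides_trans assms(3) by blast
qed

text \<open>Both the index set of the product and the exponents depend on \<open>F\<close> only
  through its divisors. This freedom supplies the factor \<open>order R - 1\<close> in the
  count.\<close>

lemma phi_poly_const_mult:
  assumes "c \<in> carrier R - {\<zero>}" "F \<in> carrier (poly_ring R)"
  shows "phi_poly R ([c] \<otimes>\<^bsub>poly_ring R\<^esub> F) = phi_poly R F"
proof -
  have val: "poly_val R P ([c] \<otimes>\<^bsub>poly_ring R\<^esub> F) = poly_val R P F" if "P \<in> monic_polys R" for P
    using that assms by (simp add: poly_val_def pdivides_const_mult_iff monic_polys_def)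
  have set: "{P \<in> monic_polys R. pirreducible (carrier R) P \<and> P pdivides ([c] \<otimes>\<^bsub>poly_ring R\<^esub> F)}
      = {P \<in> monic_polys R. pirreducible (carrier R) P \<and> P pdivides F}"
    using assms pdivides_const_mult_iff by (auto simp: monic_polys_def)
  show ?thesis
    unfolding phi_poly_def set using val
    by (intro UP.finprod_cong') (auto simp: monic_polys_def)
qed

section \<open>Construction and counting of pairs\<close>

lemma shifted_split_poly_pair:
  assumes "finite U" "U \<subseteq> carrier R" "c \<in> carrier R - {\<zero>}"
  shows "([c] \<otimes>\<^bsub>poly_ring R\<^esub> split_poly R ((\<lambda>u. u \<ominus> \<one>) ` U), split_poly R ((\<lambda>u. u \<oplus> \<one>) ` U))
    \<in> phi_sigma_pairs R (card U)"
proof -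
  define S where "S = (\<lambda>u. u \<ominus> \<one>) ` U"
  define T where "T = (\<lambda>u. u \<oplus> \<one>) ` U"
  have S: "finite S" "S \<subseteq> carrier R" and T: "finite T" "T \<subseteq> carrier R"
    using assms by (auto simp: S_def T_def)
  \<comment> \<open>Injectivity of the shifts serves twice: to reindex the products over
    \<open>U\<close>, and to keep both degrees equal to \<open>card U\<close>.\<close>
  have injS: "inj_on (\<lambda>u. u \<ominus> \<one>) U" and injT: "inj_on (\<lambda>u. u \<oplus> \<one>) U"
    using assms by (auto simp: inj_on_def a_minus_def subset_iff)
  have c: "[c] \<in> carrier (poly_ring R)"
    using assms by (auto simp: univ_poly_carrier[symmetric] polynomial_def)
  have "phi_poly R ([c] \<otimes>\<^bsub>poly_ring R\<^esub> split_poly R S) = phi_poly R (split_poly R S)"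
    using assms S by (intro phi_poly_const_mult) auto
  also have "\<dots> = (\<Otimes>\<^bsub>poly_ring R\<^esub> a\<in>S. lin_poly R (a \<oplus> \<one>))"
    using S by (rule phi_poly_split_poly)
  also have "\<dots> = (\<Otimes>\<^bsub>poly_ring R\<^esub> u\<in>U. lin_poly R ((u \<ominus> \<one>) \<oplus> \<one>))"
    unfolding S_def using assms injS by (intro UP.finprod_reindex) auto
  \<comment> \<open>Both shifted roots equal \<open>u\<close>; this is where the totient side meets
    the divisor-sum side.\<close>
  also have "\<dots> = (\<Otimes>\<^bsub>poly_ring R\<^esub> u\<in>U. lin_poly R ((u \<oplus> \<one>) \<ominus> \<one>))"
    using assms by (intro UP.finprod_cong') (auto simp: a_minus_def a_assoc l_neg r_neg)
  also have "\<dots> = (\<Otimes>\<^bsub>poly_ring R\<^esub> a\<in>T. lin_poly R (a \<ominus> \<one>))"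
    unfolding T_def using assms injT by (intro UP.finprod_reindex[symmetric]) auto
  also have "\<dots> = sigma_poly R (split_poly R T)"
    using T by (rule sigma_poly_split_poly[symmetric])
  finally have eq: "phi_poly R ([c] \<otimes>\<^bsub>poly_ring R\<^esub> split_poly R S) = sigma_poly R (split_poly R T)" .
  have "degree ([c] \<otimes>\<^bsub>poly_ring R\<^esub> split_poly R S) = card U"
    using S c split_poly_monic_degree[OF S] card_image[OF injS]
    by (subst degree_poly_ring_mult) (auto simp: monic_polys_def S_def)
  moreover have "degree (split_poly R T) = card U"
    using split_poly_monic_degree[OF T] card_image[OF injT] by (simp add: T_def)
  ultimately show ?thesis
    using eq c S T by (simp add: phi_sigma_pairs_def S_def T_def)
qed

text \<open>An injection bounds \<open>card\<close> from below only when the target is finite, since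
  \<open>card\<close> of an infinite set is 0.\<close>

lemma finite_phi_sigma_pairs:
  assumes "finite (carrier R)"
  shows "finite (phi_sigma_pairs R n)"
proof -
  \<comment> \<open>The degree is the length minus one, truncated at 0. The inequality also admits
    the empty list, which has degree 0.\<close>
  let ?L = "{xs. set xs \<subseteq> carrier R \<and> length xs \<le> Suc n}"
  have "phi_sigma_pairs R n \<subseteq> ?L \<times> ?L"
    by (auto simp: phi_sigma_pairs_def univ_poly_carrier[symmetric] polynomial_def)
  then show ?thesis
    using finite_lists_length_le[OF assms] finite_subset by blast
qed

lemma card_phi_sigma_pairs_ge:
  assumes "finite (carrier R)"
  shows "(order R - 1) * (order R choose n) \<le> card (phi_sigma_pairs R n)"
proof -
  define h where "h = (\<lambda>(c, U). ([c] \<otimes>\<^bsub>poly_ring R\<^esub> split_poly R ((\<lambda>u. u \<ominus> \<one>) ` U),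
    split_poly R ((\<lambda>u. u \<oplus> \<one>) ` U)))"
  let ?D = "(carrier R - {\<zero>}) \<times> {U. U \<subseteq> carrier R \<and> card U = n}"
  have fin: "finite U" if "U \<subseteq> carrier R" for U
    using that assms finite_subset by blast
  have "inj_on h ?D"
  proof (rule inj_onI)
    fix x y
    assume "x \<in> ?D" "y \<in> ?D" "h x = h y"
    then obtain c U d V where xy: "x = (c, U)" "y = (d, V)"
      and c: "c \<in> carrier R" "c \<noteq> \<zero>" and d: "d \<in> carrier R" "d \<noteq> \<zero>"
      and U: "U \<subseteq> carrier R" and V: "V \<subseteq> carrier R" and eq: "h (c, U) = h (d, V)"
      by blast
    let ?t = "\<lambda>u. u \<oplus> \<one>" and ?s = "\<lambda>u. u \<ominus> \<one>"
    \<comment> \<open>The second component alone determines the set: \<open>split_poly\<close>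
      recovers the shifted set, and the shift is injective.\<close>
    have "?t ` U = ?t ` V"
      using eq U V fin by (intro inj_onD[OF inj_on_split_poly]) (auto simp: h_def)
    moreover have "inj_on ?t (carrier R)"
      by (auto simp: inj_on_def)
    ultimately have UV: "U = V"
      using U V inj_on_image_eq_iff by blast
    have S: "finite (?s ` V)" "?s ` V \<subseteq> carrier R"
      using V fin by auto
    have "[c] \<in> carrier (poly_ring R)" "[d] \<in> carrier (poly_ring R)"
      using c d by (auto simp: univ_poly_carrier[symmetric] polynomial_def)
    \<comment> \<open>Once the sets agree, this nonzero polynomial can be cancelled from the first
      components, which leaves the constants.\<close>
    moreover have "split_poly R (?s ` V) \<noteq> \<zero>\<^bsub>poly_ring R\<^esub>"
      using split_poly_monic_degree[OF S] by (simp add: monic_polys_def univ_poly_zero)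
    ultimately have "[c] = [d]"
      using eq UV S UP.m_rcancel[of "split_poly R (?s ` V)" "[c]" "[d]"] by (simp add: h_def)
    then show "x = y"
      using UV xy by simp
  qed
  moreover have "h ` ?D \<subseteq> phi_sigma_pairs R n"
    using shifted_split_poly_pair fin by (auto simp: h_def)
  ultimately have "card ?D \<le> card (phi_sigma_pairs R n)"
    using finite_phi_sigma_pairs[OF assms] card_inj_on_le by blast
  moreover have "card ?D = (order R - 1) * (order R choose n)"
    using assms by (simp add: card_cartesian_product n_subsets order_def)
  ultimately show ?thesis by simp
qed

end

section \<open>The lower bound for large fields\<close>

theorem theorem1p6:
  shows "\<exists>c::real. c > 0 \<and>
    (\<forall>n::nat. n \<ge> 1 \<longrightarrow>
      (\<exists>q0::nat. \<forall>q::nat. q \<ge> q0 \<and> primepow q \<longrightarrow>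
        (\<forall>R :: 'a ring. field R \<and> order R = q \<longrightarrow>
          real (card (phi_sigma_pairs R n)) \<ge> c * real q ^ n / real n ^ 2)))"
proof -
  have bound: "real (card (phi_sigma_pairs R n)) \<ge> 1 * real (order R) ^ n / real n ^ 2"
    if n: "n \<ge> 1" and q: "order R \<ge> n ^ n + 1" and R: "field R" for n and R :: "'a ring"
  proof -
    interpret field R by (rule R)
    define q where "q = order R"
    \<comment> \<open>The order is positive, whereas an infinite carrier would have order 0.\<close>
    have fin: "finite (carrier R)"
      using q by (auto simp: order_def intro: card_ge_0_finite)
    have "n \<le> n ^ n"
      using n by (simp add: self_le_power)
    then have "n \<le> q"
      using q by (simp add: q_def)
    \<comment> \<open>Dividing by \<open>n ^ 2\<close>, which is at least 1, only decreases the
      value, so a lower bound of \<open>q ^ n\<close> suffices.\<close>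
    have "1 * real q ^ n / real n ^ 2 \<le> real q ^ n"
      using n by (simp add: divide_le_eq mult_le_cancel_left1)
    \<comment> \<open>The split matches the two factors of the count: \<open>n ^ n\<close> is at
      most \<open>q - 1\<close> by the threshold, and \<open>(q / n) ^ n\<close> is at most the
      binomial coefficient because \<open>n \<le> q\<close>.\<close>
    also have "\<dots> = real (n ^ n) * (real q / real n) ^ n"
      using n by (simp add: power_divide)
    also have "\<dots> \<le> real (q - 1) * real (q choose n)"
      using q binomial_ge_n_over_k_pow_k[OF \<open>n \<le> q\<close>, where 'a = real]
      by (intro mult_mono) (auto simp: q_def simp del: of_nat_power)
    also have "\<dots> \<le> real (card (phi_sigma_pairs R n))"
      using card_phi_sigma_pairs_ge[OF fin, of n] unfolding q_def
      by (simp only: of_nat_mult[symmetric] of_nat_le_iff)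
    finally show ?thesis
      by (simp add: q_def)
  qed
  show ?thesis
  \<comment> \<open>The constant 1 works uniformly in \<open>n\<close>; only the threshold
    \<open>n ^ n + 1\<close> depends on \<open>n\<close>.\<close>
  proof (rule exI[of _ 1], intro conjI allI impI)
    fix n :: nat
    assume n: "n \<ge> 1"
    show "\<exists>q0. \<forall>q. q \<ge> q0 \<and> primepow q \<longrightarrow>
        (\<forall>R :: 'a ring. field R \<and> order R = q \<longrightarrow>
          real (card (phi_sigma_pairs R n)) \<ge> 1 * real q ^ n / real n ^ 2)"
      using bound[OF n] by (intro exI[of _ "n ^ n + 1"]) blast
  qed simp
qed

end
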